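(* Let $G$ and $H$ be two arbitrary graphs on $n$ and $m$ vertices, respectively. Suppose that Maker (Dominator) has a winning strategy in the Maker–Breaker domination game on at least one of these two graphs both as the first and as the second player. Then $$\gamma_{MB}(G\square H)\leq \min\{\gamma_{MB}(G)+(m-1)\gamma'_{MB}(G),\ \gamma_{MB}(H)+(n-1)\gamma'_{MB}(H)\}$$ and $$\gamma'_{MB}(G\square H)\leq \min\{m\cdot\gamma_{MB}(G),\ n\cdot \gamma'_{MB}(H)\}.$$
   Context: $G\square H$ denotes the Cartesian product of graphs. In the Maker–Breaker domination game on a graph $G$, two players, Dominator (Maker) and Staller (Breaker), alternately claim previously unclaimed vertices of $G$. Dominator wins if the set of vertices he claims becomes a dominating set of $G$ (every vertex not in it has a neighbour in it); Staller wins if she claims some vertex together with all of its neighbours. In the $D$-game Dominator moves first, in the $S$-game Staller moves first. $\gamma_{MB}(G)$ is the minimum number of moves Dominator needs to win the $D$-game on $G$ against optimal play by Staller (who tries to postpone his win), and $\gamma'_{MB}(G)$ the analogous quantity for the $S$-game.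
   Formalization: In the second inequality the term m·γ_MB(G) is replaced by m·γ'_MB(G); as printed it fails, e.g. for G the wheel W_4 (hub plus C_4) and H = K_1, where γ'_MB(G□H) = 2 but m·γ_MB(G) = 1. *)

theory Defs
  imports "Graph_Theory.Pair_Digraph" "HOL-Library.Extended_Nat"
begin

(* Finite simple graphs are the locale pair_graph of the Graph_Theory entry: an explicit finite
   vertex set pverts G and a symmetric, irreflexive set of arcs parcs G, so that the undirected
   edge uv is represented by the two arcs (u, v) and (v, u). *)

definition cartesian_product ::
    "'a pair_pre_digraph \<Rightarrow> 'b pair_pre_digraph \<Rightarrow> ('a \<times> 'b) pair_pre_digraph"
    (infixr \<open>\<box>\<close> 80) where
  "G \<box> H = \<lparr> pverts = pverts G \<times> pverts H,
     parcs = {((g, h), (g', h')) | g h g' h'.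
       g = g' \<and> g \<in> pverts G \<and> (h, h') \<in> parcs H \<or>
       (g, g') \<in> parcs G \<and> h = h' \<and> h \<in> pverts H} \<rparr>"

definition dominating_set :: "'a pair_pre_digraph \<Rightarrow> 'a set \<Rightarrow> bool" where
  "dominating_set G A \<longleftrightarrow>
     A \<subseteq> pverts G \<and> (\<forall>v \<in> pverts G - A. \<exists>u \<in> A. (v, u) \<in> parcs G)"

(* In the D-game Dominator moves first, in the S-game Staller does. *)
datatype game = D_game | S_game

(* Moves are numbered from 0. *)
fun dominator_turn :: "game \<Rightarrow> nat \<Rightarrow> bool" where
  "dominator_turn D_game i \<longleftrightarrow> even i"
| "dominator_turn S_game i \<longleftrightarrow> odd i"

(* A strategy maps the list of all moves made so far, by both players and in chronological order,
   to an unclaimed vertex. Its values on histories in which it is not Dominator's turn are never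
   used. *)
definition dominator_strategy :: "'a pair_pre_digraph \<Rightarrow> ('a list \<Rightarrow> 'a) \<Rightarrow> bool" where
  "dominator_strategy G \<sigma> \<longleftrightarrow>
     (\<forall>h. distinct h \<and> set h \<subset> pverts G \<longrightarrow> \<sigma> h \<in> pverts G - set h)"

(* All plays in which Dominator follows the given strategy and Staller moves arbitrarily. Every
   play is continued until all vertices are claimed; this does not affect who wins, because a
   dominating set stays dominating when Dominator claims further vertices. *)
definition plays :: "'a pair_pre_digraph \<Rightarrow> game \<Rightarrow> ('a list \<Rightarrow> 'a) \<Rightarrow> 'a list set" where
  "plays G t \<sigma> = {p. distinct p \<and> set p = pverts G \<and>
     (\<forall>i < length p. dominator_turn t i \<longrightarrow> p ! i = \<sigma> (take i p))}"

definition dominator_moves :: "game \<Rightarrow> 'a list \<Rightarrow> 'a list" where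
  "dominator_moves t p = nths p {i. dominator_turn t i}"

definition staller_moves :: "game \<Rightarrow> 'a list \<Rightarrow> 'a list" where
  "staller_moves t p = nths p {i. \<not> dominator_turn t i}"

definition dominator_wins_play :: "'a pair_pre_digraph \<Rightarrow> game \<Rightarrow> 'a list \<Rightarrow> bool" where
  "dominator_wins_play G t p \<longleftrightarrow> dominating_set G (set (dominator_moves t p))"

definition staller_wins_play :: "'a pair_pre_digraph \<Rightarrow> game \<Rightarrow> 'a list \<Rightarrow> bool" where
  "staller_wins_play G t p \<longleftrightarrow>
     (\<exists>v \<in> pverts G. insert v {u. (v, u) \<in> parcs G} \<subseteq> set (staller_moves t p))"

definition dominator_has_winning_strategy :: "'a pair_pre_digraph \<Rightarrow> game \<Rightarrow> bool" where
  "dominator_has_winning_strategy G t \<longleftrightarrow>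
     (\<exists>\<sigma>. dominator_strategy G \<sigma> \<and> (\<forall>p \<in> plays G t \<sigma>. dominator_wins_play G t p))"

(* The number of moves made by Dominator (Staller's are not counted) up to and including the one
   that wins the play; the infimum of the empty set is infinity, so a lost play has value
   infinity. *)
definition winning_time :: "'a pair_pre_digraph \<Rightarrow> game \<Rightarrow> 'a list \<Rightarrow> enat" where
  "winning_time G t p =
     (INF k \<in> {k. k \<le> length (dominator_moves t p) \<and>
                  dominating_set G (set (take k (dominator_moves t p)))}. enat k)"

(* Dominator minimises and Staller maximises the winning time; the value is infinity if Dominator
   has no winning strategy. *)
definition game_value :: "'a pair_pre_digraph \<Rightarrow> game \<Rightarrow> enat" where
  "game_value G t = (INF \<sigma> \<in> {\<sigma>. dominator_strategy G \<sigma>}. SUP p \<in> plays G t \<sigma>. winning_time G t p)"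

definition gamma_MB :: "'a pair_pre_digraph \<Rightarrow> enat" (\<open>\<gamma>\<^sub>M\<^sub>B\<close>) where
  "\<gamma>\<^sub>M\<^sub>B G = game_value G D_game"

definition gamma_MB' :: "'a pair_pre_digraph \<Rightarrow> enat" (\<open>\<gamma>''\<^sub>M\<^sub>B\<close>) where
  "\<gamma>'\<^sub>M\<^sub>B G = game_value G S_game"

lemma pair_graph_cartesian_product:
  assumes "pair_graph G" "pair_graph H"
  shows "pair_graph (G \<box> H)"
proof -
  interpret G: pair_graph G by fact
  interpret H: pair_graph H by fact
  have sub: "parcs (G \<box> H) \<subseteq> (pverts G \<times> pverts H) \<times> (pverts G \<times> pverts H)"
    using G.arc_fst_in_verts G.arc_snd_in_verts H.arc_fst_in_verts H.arc_snd_in_verts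
    by (fastforce simp: cartesian_product_def)
  have fin: "finite (pverts G \<times> pverts H)"
    using G.pair_finite_verts H.pair_finite_verts by simp
  have finite_arcs: "finite (parcs (G \<box> H))"
    using finite_subset[OF sub] fin by blast
  have symG: "sym (parcs G)" and symH: "sym (parcs H)"
    using G.pair_sym_arcs H.pair_sym_arcs by (auto simp: symmetric_def)
  have "sym (parcs (G \<box> H))"
    using symG symH unfolding sym_def cartesian_product_def by auto
  then have "symmetric (with_proj (G \<box> H))"
    by (simp add: symmetric_def)
  moreover have "fst e \<noteq> snd e" if "e \<in> parcs (G \<box> H)" for e
    using that G.pair_no_loops H.pair_no_loops by (fastforce simp: cartesian_product_def)
  moreover have "pverts (G \<box> H) = pverts G \<times> pverts H"
    by (simp add: cartesian_product_def)
  moreover have "fst e \<in> pverts G \<times> pverts H" "snd e \<in> pverts G \<times> pverts H"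
    if "e \<in> parcs (G \<box> H)" for e
    using sub that by (auto simp: mem_Times_iff)
  ultimately show ?thesis
    using fin finite_arcs by unfold_locales auto
qed

lemma staller_wins_play_iff:
  assumes "pair_graph G" "p \<in> plays G t \<sigma>"
  shows "staller_wins_play G t p \<longleftrightarrow> \<not> dominator_wins_play G t p"
proof -
  interpret G: pair_graph G by fact
  let ?D = "set (dominator_moves t p)" and ?S = "set (staller_moves t p)"
  have p: "distinct p" "set p = pverts G"
    using assms(2) by (auto simp: plays_def)
  have D: "?D = {p ! i | i. i < length p \<and> dominator_turn t i}"
    and S: "?S = {p ! i | i. i < length p \<and> \<not> dominator_turn t i}"
    by (auto simp: dominator_moves_def staller_moves_def set_nths)
  have "?D \<union> ?S = pverts G"
    unfolding D S p(2)[symmetric] set_conv_nth[of p] by blast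
  moreover have "?D \<inter> ?S = {}"
    unfolding D S using p(1) by (auto simp: nth_eq_iff_index_eq)
  ultimately have "?S = pverts G - ?D" and "?D \<subseteq> pverts G" by auto
  moreover have "u \<in> pverts G" if "(v, u) \<in> parcs G" for u v
    using G.arc_snd_in_verts that by force
  ultimately show ?thesis
    unfolding staller_wins_play_def dominator_wins_play_def dominating_set_def by auto
qed

end

(* Dominator plays the games on the m copies of G in parallel. A copy in position (D, U), with k
   further moves guaranteed to suffice when Staller moves next, gets budget k. If Staller moves in
   a copy that is not yet dominated, Dominator answers there; if she moves in a dominated copy,
   Dominator treats this as a pass and moves in some copy that is not yet dominated, which by
   monotonicity in the position still lowers the budget of that copy by one. So every move of
   Dominator lowers the total budget by one, and once all copies are dominated so is the product. *)

theory Submission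
  imports Defs
begin

section \<open>Values of positions\<close>

text \<open>In a position, \<open>D\<close> is the set of vertices of Dominator and \<open>U\<close> the set of unclaimed vertices;
  \<open>W\<close> recognises the sets that are winning for Dominator. Staller is to move in
  \<open>wins_second\<close>, Dominator in \<open>wins_first\<close>; \<open>k\<close> bounds the number of further moves of Dominator.\<close>

fun wins_second :: "('a set \<Rightarrow> bool) \<Rightarrow> nat \<Rightarrow> 'a set \<Rightarrow> 'a set \<Rightarrow> bool" where
  "wins_second W 0 D U \<longleftrightarrow> W D"
| "wins_second W (Suc k) D U \<longleftrightarrow> W D \<or>
     U \<noteq> {} \<and> (\<forall>x\<in>U. \<exists>y\<in>U - {x}. wins_second W k (insert y D) (U - {x} - {y}))"

fun wins_first :: "('a set \<Rightarrow> bool) \<Rightarrow> nat \<Rightarrow> 'a set \<Rightarrow> 'a set \<Rightarrow> bool" where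
  "wins_first W 0 D U \<longleftrightarrow> W D"
| "wins_first W (Suc k) D U \<longleftrightarrow> W D \<or> (\<exists>y\<in>U. wins_second W k (insert y D) (U - {y}))"

lemma wins_second_won: "W D \<Longrightarrow> wins_second W k D U"
  by (cases k) auto

lemma wins_second_Suc: "wins_second W k D U \<Longrightarrow> wins_second W (Suc k) D U"
proof (induction k arbitrary: D U)
  case (Suc k)
  then show ?case by (metis wins_second.simps(2))
qed simp

lemma wins_second_le: "wins_second W k D U \<Longrightarrow> k \<le> l \<Longrightarrow> wins_second W l D U"
  by (induction l) (auto simp: le_Suc_eq simp del: wins_second.simps intro: wins_second_Suc)

text \<open>Every vertex that Dominator gains comes from \<open>U\<close>, so whatever set he wins
  with lies inside \<open>D \<union> U\<close>. This is how free vertices are found below: a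
  position that can be won but is not won yet must still have an unclaimed vertex.\<close>

lemma wins_second_total:
  assumes "mono W" "wins_second W k D U"
  shows "W (D \<union> U)"
  using assms(2)
proof (induction k arbitrary: D U)
  case 0
  then show ?case using monoD[OF assms(1), of D "D \<union> U"] by auto
next
  case (Suc k)
  show ?case
  proof (cases "W D")
    case True
    then show ?thesis using monoD[OF assms(1), of D "D \<union> U"] by auto
  next
    case False
    with Suc.prems obtain x where "x \<in> U"
      and "\<exists>y\<in>U - {x}. wins_second W k (insert y D) (U - {x} - {y})"
      by auto
    then obtain y where "y \<in> U" and "wins_second W k (insert y D) (U - {x} - {y})" by blast
    then have "W (insert y D \<union> (U - {x} - {y}))" using Suc.IH by blast
    moreover have "insert y D \<union> (U - {x} - {y}) \<subseteq> D \<union> U" using \<open>y \<in> U\<close> by auto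
    ultimately show ?thesis using monoD[OF assms(1)] by (metis le_boolD)
  qed
qed

text \<open>Dominator imagines the position \<open>(D, U)\<close> beside the real one
  \<open>(D', U')\<close> and copies his replies from it. The inclusion
  \<open>D \<union> U \<subseteq> D' \<union> U'\<close> says that a vertex not lost to Staller in
  the imagined position is not lost in the real one either.\<close>

lemma wins_second_mono:
  assumes "mono W" "wins_second W k D U"
    and "D \<subseteq> D'" "D \<union> U \<subseteq> D' \<union> U'" "D \<inter> U = {}" "D' \<inter> U' = {}"
  shows "wins_second W k D' U'"
  using assms(2-)
proof (induction k arbitrary: D U D' U')
  case 0
  then show ?case using monoD[OF assms(1), of D D'] by auto
next
  case (Suc k)
  have up: "W B" if "W A" "A \<subseteq> B" for A B
    using monoD[OF assms(1) that(2)] that(1) by auto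
  show ?case
  proof (cases "W D'")
    case True
    then show ?thesis by simp
  next
    case False
    then have "\<not> W D" using up Suc.prems(2) by blast
    with Suc.prems(1) have "U \<noteq> {}"
      and reply: "\<And>x. x \<in> U \<Longrightarrow> \<exists>y\<in>U - {x}. wins_second W k (insert y D) (U - {x} - {y})"
      by auto
    have "W (D \<union> U)" using wins_second_total[OF assms(1) Suc.prems(1)] .
    then have "U' \<noteq> {}" using False up Suc.prems(3) by (metis Un_empty_right)
    moreover have "\<exists>y\<in>U' - {x}. wins_second W k (insert y D') (U' - {x} - {y})" if x: "x \<in> U'" for x
    proof -
      \<comment> \<open>Staller's imagined move is her real one if it is available in
        \<open>U\<close>, and arbitrary otherwise. In the second case \<open>x\<close> lies outside
        \<open>D \<union> U\<close>, so losing it costs nothing.\<close>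
      define x0 where "x0 = (if x \<in> U then x else SOME u. u \<in> U)"
      have "x0 \<in> U" using \<open>U \<noteq> {}\<close> by (auto simp: x0_def some_in_eq)
      then obtain y where y: "y \<in> U" "y \<noteq> x0"
        and win: "wins_second W k (insert y D) (U - {x0} - {y})"
        using reply by blast
      have "x \<notin> D'" using x Suc.prems(5) by auto
      then have sub: "insert y D \<union> (U - {x0} - {y}) \<subseteq> D' \<union> (U' - {x})"
        using Suc.prems(2-5) y \<open>x0 \<in> U\<close> by (auto simp: x0_def split: if_splits)
      \<comment> \<open>If the copied reply \<open>y\<close> already belongs to Dominator, any free
        \<open>z\<close> serves instead; one exists because otherwise \<open>D'\<close> would itself
        be winning.\<close>
      have "\<exists>z\<in>U' - {x}. insert y D \<subseteq> insert z D'"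
      proof (cases "y \<in> D'")
        case True
        have "W (D' \<union> (U' - {x}))"
          using up[OF wins_second_total[OF assms(1) win] sub] .
        then have "U' - {x} \<noteq> {}" using False by (metis Un_empty_right)
        then show ?thesis using True Suc.prems(2) by auto
      next
        case False
        then have "y \<in> U' - {x}" using sub by auto
        then show ?thesis using Suc.prems(2) by auto
      qed
      then obtain z where z: "z \<in> U' - {x}" "insert y D \<subseteq> insert z D'" by blast
      have "wins_second W k (insert z D') (U' - {x} - {z})"
      proof (rule Suc.IH[OF win z(2)])
        show "insert y D \<union> (U - {x0} - {y}) \<subseteq> insert z D' \<union> (U' - {x} - {z})" using sub by auto
        show "insert y D \<inter> (U - {x0} - {y}) = {}" using Suc.prems(4) by auto
        show "insert z D' \<inter> (U' - {x} - {z}) = {}" using Suc.prems(5) by auto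
      qed
      then show ?thesis using z by blast
    qed
    ultimately show ?thesis by simp
  qed
qed

text \<open>When Staller passes, Dominator invents a move \<open>x\<close> for her and gives his
  reply to it. The invented \<open>x\<close> in fact stays unclaimed, which by monotonicity is no
  worse for him, so a pass still lowers the budget by one.\<close>

lemma wins_second_pass:
  assumes "mono W" "wins_second W (Suc k) D U" "\<not> W D" "D \<inter> U = {}"
  shows "\<exists>y\<in>U. wins_second W k (insert y D) (U - {y})"
proof -
  obtain x where "x \<in> U" and "\<exists>y\<in>U - {x}. wins_second W k (insert y D) (U - {x} - {y})"
    using assms(2,3) by auto
  then obtain y where y: "y \<in> U" and win: "wins_second W k (insert y D) (U - {x} - {y})"
    by blast
  have "wins_second W k (insert y D) (U - {y})"
    by (rule wins_second_mono[OF assms(1) win]) (use assms(4) in auto)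
  then show ?thesis using y by blast
qed

section \<open>Playing several games in parallel\<close>

text \<open>A position of the large game is read in copy \<open>j\<close> through the preimages of
  \<open>D\<close> and \<open>U\<close> under \<open>e j\<close>. \<open>W'I\<close> is only an
  implication: in a product, vertices may also be dominated from neighbouring copies.\<close>

locale parallel_games =
  fixes J :: "'j set" and e :: "'j \<Rightarrow> 'a \<Rightarrow> 'c" and W :: "'a set \<Rightarrow> bool" and W' :: "'c set \<Rightarrow> bool"
  assumes finite_J: "finite J"
    and e_inject: "e i x = e j y \<longleftrightarrow> i = j \<and> x = y"
    and mono_W: "mono W"
    and W'I: "(\<And>j. j \<in> J \<Longrightarrow> W (e j -` D)) \<Longrightarrow> W' D"
begin

lemma vimage_insert_e:
  "e i -` insert (e j y) D = (if i = j then insert y (e i -` D) else e i -` D)"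
  by (auto simp: e_inject)

lemma vimage_remove_e:
  "e i -` (U - {e j y}) = (if i = j then (e i -` U) - {y} else e i -` U)"
  by (auto simp: e_inject)

lemma sum_decrease:
  assumes "j \<in> J" "k j = Suc l"
  shows "sum k J = Suc (sum (k(j := l)) J)"
  using assms finite_J by (simp add: sum.remove[of J j])

text \<open>The induction runs over the total budget with \<open>k\<close> left arbitrary, since
  Staller's move decides which copy's budget is lowered.\<close>

lemma wins_second_parallel:
  assumes "\<And>j. j \<in> J \<Longrightarrow> wins_second W (k j) (e j -` D) (e j -` U)"
    and "D \<inter> U = {}" "U \<subseteq> (\<Union>j\<in>J. range (e j))"
  shows "wins_second W' (sum k J) D U"
  using assms
proof (induction "sum k J" arbitrary: k D U)
  case 0
  then have "W (e j -` D)" if "j \<in> J" for j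
    using that finite_J by (metis sum_eq_0_iff wins_second.simps(1))
  then show ?case using 0(1)[symmetric] W'I by simp
next
  case (Suc K)
  show ?case
  proof (cases "\<forall>j\<in>J. W (e j -` D)")
    case True
    then show ?thesis using W'I wins_second_won by blast
  next
    case False
    then obtain j0 where j0: "j0 \<in> J" "\<not> W (e j0 -` D)" by blast
    have budget: "\<exists>l. k j = Suc l" if "j \<in> J" "\<not> W (e j -` D)" for j
      using Suc.prems(1)[OF that(1)] that(2) by (cases "k j") auto
    obtain l0 where l0: "k j0 = Suc l0" using budget j0 by blast
    have disj: "e j -` D \<inter> e j -` U = {}" for j using Suc.prems(2) by auto
    \<comment> \<open>Bookkeeping common to both kinds of reply: Staller took \<open>u\<close>,
      possibly in another copy, and Dominator answers with \<open>y\<close> in copy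
      \<open>j\<close>, whose budget drops from \<open>k j\<close> to \<open>l\<close>.\<close>
    have step: "wins_second W' K (insert (e j y) D) (U - {u} - {e j y})"
      if "j \<in> J" "k j = Suc l"
        and "wins_second W l (insert y (e j -` D)) (e j -` (U - {u}) - {y})"
        and others: "\<And>i. i \<in> J \<Longrightarrow> i \<noteq> j \<Longrightarrow> wins_second W (k i) (e i -` D) (e i -` (U - {u}))"
      for j y l u
    proof -
      have K: "K = sum (k(j := l)) J"
        using Suc.hyps(2) sum_decrease[where k = k] that(1,2) by simp
      show ?thesis unfolding K
      proof (rule Suc.hyps(1)[OF K])
        fix i assume "i \<in> J"
        then show "wins_second W ((k(j := l)) i) (e i -` insert (e j y) D)
            (e i -` (U - {u} - {e j y}))"
          using that(3) others[of i] unfolding vimage_insert_e vimage_remove_e by auto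
      qed (use Suc.prems(2,3) in auto)
    qed
    have "\<exists>y\<in>U - {u}. wins_second W' K (insert y D) (U - {u} - {y})" if "u \<in> U" for u
    proof -
      obtain j x where j: "j \<in> J" and u: "u = e j x" using Suc.prems(3) \<open>u \<in> U\<close> by auto
      have others: "wins_second W (k i) (e i -` D) (e i -` (U - {u}))" if "i \<in> J" "i \<noteq> j" for i
        using Suc.prems(1)[OF that(1)] that(2) unfolding u vimage_remove_e by simp
      show ?thesis
      proof (cases "W (e j -` D)")
        case True
        then have ne: "j0 \<noteq> j" using j0 by auto
        have "wins_second W (Suc l0) (e j0 -` D) (e j0 -` U)"
          using Suc.prems(1)[OF j0(1)] l0 by simp
        then obtain y where y: "y \<in> e j0 -` U"
          and win: "wins_second W l0 (insert y (e j0 -` D)) (e j0 -` U - {y})"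
          using wins_second_pass[OF mono_W _ j0(2) disj] by blast
        have "wins_second W' K (insert (e j0 y) D) (U - {u} - {e j0 y})"
        proof (rule step[OF j0(1) l0])
          show "wins_second W l0 (insert y (e j0 -` D)) (e j0 -` (U - {u}) - {y})"
            using win ne unfolding u vimage_remove_e by simp
          \<comment> \<open>Copy \<open>j\<close> has lost \<open>x\<close> to Staller, but it is
            already won, so its budget \<open>k j\<close> remains valid.\<close>
          show "wins_second W (k i) (e i -` D) (e i -` (U - {u}))" if "i \<in> J" for i
            using others[OF that] wins_second_won[of W, OF True] by (cases "i = j") auto
        qed
        moreover have "e j0 y \<in> U - {u}" using y ne by (simp add: u e_inject)
        ultimately show ?thesis by blast
      next
        case False
        then obtain l where l: "k j = Suc l" using budget j by blast
        have "x \<in> e j -` U" using \<open>u \<in> U\<close> u by simp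
        then obtain y where y: "y \<in> e j -` U - {x}"
          and win: "wins_second W l (insert y (e j -` D)) (e j -` U - {x} - {y})"
          using Suc.prems(1)[OF j] False unfolding l by auto
        have "wins_second W' K (insert (e j y) D) (U - {u} - {e j y})"
          by (rule step[OF j l _ others]) (use win in \<open>auto simp: u vimage_remove_e\<close>)
        moreover have "e j y \<in> U - {u}" using y by (simp add: u e_inject)
        ultimately show ?thesis by blast
      qed
    qed
    moreover have "U \<noteq> {}"
      using wins_second_pass[OF mono_W _ j0(2) disj, of l0] Suc.prems(1)[OF j0(1)] l0 by auto
    ultimately show ?thesis unfolding Suc.hyps(2)[symmetric] by simp
  qed
qed

text \<open>Dominator opens in \<open>j0\<close>; afterwards Staller is to move in every copy and
  the previous lemma applies. Since copy \<open>j0\<close> is not won yet, \<open>wins_first\<close>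
  supplies an actual opening move and \<open>a\<close> is positive.\<close>

lemma wins_first_parallel:
  assumes "j0 \<in> J" "wins_first W a (e j0 -` D) (e j0 -` U)"
    and "\<And>j. j \<in> J - {j0} \<Longrightarrow> wins_second W b (e j -` D) (e j -` U)"
    and "D \<inter> U = {}" "U \<subseteq> (\<Union>j\<in>J. range (e j))" "\<not> W (e j0 -` D)"
  shows "wins_first W' (a + (card J - 1) * b) D U"
proof -
  obtain a' y where a: "a = Suc a'" and y: "y \<in> e j0 -` U"
    and win: "wins_second W a' (insert y (e j0 -` D)) (e j0 -` U - {y})"
    using assms(2,6) by (cases a) auto
  define k where "k = (\<lambda>j. if j = j0 then a' else b)"
  have "sum k J = a' + (card J - 1) * b"
    using assms(1) finite_J by (simp add: sum.remove[of J j0] k_def)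
  moreover have "wins_second W' (sum k J) (insert (e j0 y) D) (U - {e j0 y})"
  proof (rule wins_second_parallel)
    show "wins_second W (k j) (e j -` insert (e j0 y) D) (e j -` (U - {e j0 y}))" if "j \<in> J" for j
      using win assms(3)[of j] that unfolding vimage_insert_e vimage_remove_e k_def by auto
  qed (use assms(4,5) in auto)
  ultimately show ?thesis using y by (auto simp: a)
qed

end

section \<open>Strategies and values of positions\<close>

text \<open>Dropping \<open>A \<subseteq> pverts G\<close> from \<open>dominating_set\<close> makes
  the predicate monotone on all sets, as the lemmas on positions demand.\<close>

definition dominating :: "'a pair_pre_digraph \<Rightarrow> 'a set \<Rightarrow> bool" where
  "dominating G A \<longleftrightarrow> (\<forall>v \<in> pverts G - A. \<exists>u \<in> A. (v, u) \<in> parcs G)"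

lemma mono_dominating: "mono (dominating G)"
  by (rule monoI) (unfold dominating_def le_bool_def, blast)

lemma dominating_set_iff: "dominating_set G A \<longleftrightarrow> A \<subseteq> pverts G \<and> dominating G A"
  by (simp add: dominating_set_def dominating_def)

lemma dominator_turn_Suc: "dominator_turn t (Suc i) \<longleftrightarrow> \<not> dominator_turn t i"
  by (cases t) auto

lemma dominator_moves_Nil [simp]: "dominator_moves t [] = []"
  by (simp add: dominator_moves_def)

lemma dominator_moves_snoc:
  "dominator_moves t (h @ [x]) = dominator_moves t h @ (if dominator_turn t (length h) then [x] else [])"
  by (simp add: dominator_moves_def nths_append)

lemma dominator_moves_prefix: "\<exists>r. dominator_moves t (h @ q) = dominator_moves t h @ r"
  by (auto simp: dominator_moves_def nths_append)

lemma set_dominator_moves: "set (dominator_moves t h) \<subseteq> set h"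
  by (simp add: dominator_moves_def set_nths_subset)

text \<open>A finite bound on an infimum in \<open>enat\<close> is attained: \<open>\<le> m\<close>
  is the same as \<open>< Suc m\<close>, and a strict bound yields a witness through
  \<open>INF_less_iff\<close>. The proof of \<open>game_value_leD\<close> uses the same device to
  obtain a strategy.\<close>

lemma INF_enat_le_iff: "(INF k\<in>A. enat k) \<le> enat m \<longleftrightarrow> (\<exists>k\<in>A. k \<le> m)"
proof
  assume "(INF k\<in>A. enat k) \<le> enat m"
  then have "(INF k\<in>A. enat k) < enat (Suc m)" using order_le_less_trans by fastforce
  then show "\<exists>k\<in>A. k \<le> m" by (auto simp: INF_less_iff less_Suc_eq_le)
qed (auto intro: INF_lower2)

lemma winning_time_le_iff:
  "winning_time G t p \<le> enat m \<longleftrightarrow>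
     (\<exists>k\<le>m. k \<le> length (dominator_moves t p) \<and> dominating_set G (set (take k (dominator_moves t p))))"
  unfolding winning_time_def INF_enat_le_iff by auto

lemma winning_time_leI:
  assumes "set p = pverts G" "dominating G (set (dominator_moves t (take i p)))"
  shows "winning_time G t p \<le> enat (length (dominator_moves t (take i p)))"
proof -
  obtain r where r: "dominator_moves t p = dominator_moves t (take i p) @ r"
    using dominator_moves_prefix by (metis append_take_drop_id)
  have "set (dominator_moves t (take i p)) \<subseteq> pverts G"
    using set_dominator_moves set_take_subset assms(1) by (metis subset_trans)
  then show ?thesis
    using assms(2) unfolding winning_time_le_iff
    by (intro exI[of _ "length (dominator_moves t (take i p))"]) (auto simp: r dominating_set_iff)
qed

text \<open>Either \<open>m\<close> moves of Dominator already lie in \<open>h\<close>, or the play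
  ends with \<open>h\<close>; in both cases the winning initial segment of his moves is contained in
  his moves in \<open>h\<close>.\<close>

lemma winning_time_leD:
  assumes "winning_time G t (h @ q) \<le> enat m" "m \<le> length (dominator_moves t h) \<or> q = []"
  shows "dominating G (set (dominator_moves t h))"
proof -
  obtain r where r: "dominator_moves t (h @ q) = dominator_moves t h @ r"
    using dominator_moves_prefix by blast
  obtain k where k: "k \<le> m" "k \<le> length (dominator_moves t (h @ q))"
    and dom: "dominating G (set (take k (dominator_moves t (h @ q))))"
    using assms(1) unfolding winning_time_le_iff dominating_set_iff by blast
  have "k \<le> length (dominator_moves t h)" using assms(2) k by auto
  then have "set (take k (dominator_moves t (h @ q))) \<subseteq> set (dominator_moves t h)"
    by (simp add: r set_take_subset)
  then show ?thesis using monoD[OF mono_dominating] dom by (metis le_boolD)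
qed

section \<open>From a strategy to a winning position\<close>

definition partial_plays :: "'a pair_pre_digraph \<Rightarrow> game \<Rightarrow> ('a list \<Rightarrow> 'a) \<Rightarrow> 'a list set" where
  "partial_plays G t \<sigma> = {h. distinct h \<and> set h \<subseteq> pverts G \<and>
     (\<forall>i < length h. dominator_turn t i \<longrightarrow> h ! i = \<sigma> (take i h))}"

lemma plays_iff: "p \<in> plays G t \<sigma> \<longleftrightarrow> p \<in> partial_plays G t \<sigma> \<and> set p = pverts G"
  by (auto simp: plays_def partial_plays_def)

lemma Nil_partial_plays: "[] \<in> partial_plays G t \<sigma>"
  by (simp add: partial_plays_def)

lemma partial_plays_snoc:
  assumes "h \<in> partial_plays G t \<sigma>" "x \<in> pverts G - set h"
    and "dominator_turn t (length h) \<Longrightarrow> x = \<sigma> h"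
  shows "h @ [x] \<in> partial_plays G t \<sigma>"
  using assms by (auto simp: partial_plays_def nth_append less_Suc_eq)

text \<open>Bounds on winning times concern complete plays only; an extension makes them applicable
  to a history.\<close>

lemma partial_plays_extend:
  assumes "finite (pverts G)" "dominator_strategy G \<sigma>" "h \<in> partial_plays G t \<sigma>"
  shows "\<exists>q. h @ q \<in> plays G t \<sigma>"
  using assms(3)
proof (induction "card (pverts G - set h)" arbitrary: h)
  case 0
  then show ?case using assms(1)
    by (intro exI[of _ "[]"]) (auto simp: plays_iff partial_plays_def)
next
  case (Suc c)
  have h: "distinct h" "set h \<subset> pverts G"
    using Suc.prems Suc.hyps(2) by (auto simp: partial_plays_def)
  \<comment> \<open>Staller's moves are unrestricted, so \<open>\<sigma>\<close> may choose them as
    well, whoever's turn it is.\<close>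
  define x where "x = \<sigma> h"
  have x: "x \<in> pverts G - set h"
    using assms(2) h unfolding dominator_strategy_def x_def by blast
  then have hx: "h @ [x] \<in> partial_plays G t \<sigma>"
    using partial_plays_snoc[OF Suc.prems x] by (simp add: x_def)
  have "pverts G - set (h @ [x]) = pverts G - set h - {x}" by auto
  then have "c = card (pverts G - set (h @ [x]))"
    using Suc.hyps(2) x assms(1) by simp
  then show ?case using Suc.hyps(1)[OF _ hx] by auto
qed

text \<open>Here \<open>k\<close> counts what is left after Dominator's moves in \<open>h\<close>.
  The hypothesis covers all continuations, hence every next move \<open>x\<close> of Staller, and
  the answer \<open>\<sigma> (h @ [x])\<close> is the required \<open>y\<close>.\<close>

lemma partial_play_wins_second:
  assumes "finite (pverts G)" "dominator_strategy G \<sigma>"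
    and "h \<in> partial_plays G t \<sigma>" "\<not> dominator_turn t (length h)"
    and "\<And>q. h @ q \<in> plays G t \<sigma> \<Longrightarrow>
      winning_time G t (h @ q) \<le> enat (length (dominator_moves t h) + k)"
  shows "wins_second (dominating G) k (set (dominator_moves t h)) (pverts G - set h)"
  using assms(3-)
proof (induction k arbitrary: h)
  case 0
  obtain q where "h @ q \<in> plays G t \<sigma>"
    using partial_plays_extend[OF assms(1,2) 0(1)] by blast
  then show ?case using winning_time_leD 0(3) by fastforce
next
  case (Suc k)
  let ?D = "set (dominator_moves t h)" and ?U = "pverts G - set h"
  show ?case
  proof (cases "dominating G ?D")
    case True
    then show ?thesis by simp
  next
    case False
    have "?U \<noteq> {}"
    proof
      assume "?U = {}"
      then have "h @ [] \<in> plays G t \<sigma>" using Suc.prems(1) by (auto simp: plays_iff partial_plays_def)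
      from Suc.prems(3)[OF this] show False using winning_time_leD False by blast
    qed
    moreover have "\<exists>y\<in>?U - {x}. wins_second (dominating G) k (insert y ?D) (?U - {x} - {y})"
      if x: "x \<in> ?U" for x
    proof -
      let ?h = "h @ [x]"
      have hx: "?h \<in> partial_plays G t \<sigma>"
        using partial_plays_snoc[OF Suc.prems(1) x] Suc.prems(2) by blast
      have D: "dominator_moves t ?h = dominator_moves t h"
        using Suc.prems(2) by (simp add: dominator_moves_snoc)
      have "set ?h \<noteq> pverts G"
      proof
        assume "set ?h = pverts G"
        then have "?h \<in> plays G t \<sigma>" using hx by (simp add: plays_iff)
        from Suc.prems(3)[OF this] have "dominating G (set (dominator_moves t ?h))"
          using winning_time_leD[of G t ?h "[]"] by simp
        then show False using False D by simp
      qed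
      then have "distinct ?h" "set ?h \<subset> pverts G"
        using hx by (auto simp: partial_plays_def)
      then have y: "\<sigma> ?h \<in> pverts G - set ?h"
        using assms(2) unfolding dominator_strategy_def by blast
      let ?y = "\<sigma> ?h"
      have hxy: "?h @ [?y] \<in> partial_plays G t \<sigma>"
        using partial_plays_snoc[OF hx y] by blast
      have turn: "dominator_turn t (length ?h)" using Suc.prems(2) by (simp add: dominator_turn_Suc)
      have Dy: "dominator_moves t (?h @ [?y]) = dominator_moves t h @ [?y]"
        using turn D unfolding dominator_moves_snoc[of t ?h] by simp
      have "wins_second (dominating G) k (set (dominator_moves t (?h @ [?y]))) (pverts G - set (?h @ [?y]))"
      proof (rule Suc.IH[OF hxy])
        show "\<not> dominator_turn t (length (?h @ [?y]))" using turn by (simp add: dominator_turn_Suc)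
        show "winning_time G t ((?h @ [?y]) @ q) \<le> enat (length (dominator_moves t (?h @ [?y])) + k)"
          if "(?h @ [?y]) @ q \<in> plays G t \<sigma>" for q
          using Suc.prems(3)[of "x # ?y # q"] that unfolding Dy by simp
      qed
      moreover have "pverts G - set (?h @ [?y]) = ?U - {x} - {?y}" by auto
      moreover have "set (dominator_moves t (?h @ [?y])) = insert ?y ?D" unfolding Dy by simp
      ultimately have "wins_second (dominating G) k (insert ?y ?D) (?U - {x} - {?y})"
        by (simp only:)
      moreover have "?y \<in> ?U - {x}" using y by simp
      ultimately show ?thesis by blast
    qed
    ultimately show ?thesis by simp
  qed
qed

lemma game_value_leD:
  assumes "game_value G t \<le> enat k"
  obtains \<sigma> where "dominator_strategy G \<sigma>" "\<And>p. p \<in> plays G t \<sigma> \<Longrightarrow> winning_time G t p \<le> enat k"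
proof -
  have "game_value G t < enat (Suc k)" using assms order_le_less_trans by fastforce
  then obtain \<sigma> where "dominator_strategy G \<sigma>" and "(SUP p \<in> plays G t \<sigma>. winning_time G t p) < enat (Suc k)"
    unfolding game_value_def INF_less_iff by auto
  moreover from this(2) have "(SUP p \<in> plays G t \<sigma>. winning_time G t p) \<le> enat k"
    using enat_iless by fastforce
  ultimately show ?thesis using that by (simp add: SUP_le_iff)
qed

section \<open>From a winning position to a strategy\<close>

definition best_move :: "('a set \<Rightarrow> bool) \<Rightarrow> 'a set \<Rightarrow> 'a set \<Rightarrow> 'a" where
  "best_move W D U = (if \<exists>k. \<exists>y\<in>U. wins_second W k (insert y D) (U - {y})
     then SOME y. y \<in> U \<and> wins_second W (LEAST k. \<exists>y\<in>U. wins_second W k (insert y D) (U - {y}))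
       (insert y D) (U - {y})
     else SOME y. y \<in> U)"

text \<open>The choice of a move may not depend on the remaining budget. A move that is good for the
  \<open>LEAST\<close> budget is good for every larger one by \<open>wins_second_le\<close>. The
  fallback in \<open>best_move\<close> keeps the choice legal where no move wins.\<close>

lemma best_move_wins:
  assumes "\<exists>y\<in>U. wins_second W k (insert y D) (U - {y})"
  shows "best_move W D U \<in> U"
    and "wins_second W k (insert (best_move W D U) D) (U - {best_move W D U})"
proof -
  let ?P = "\<lambda>k. \<exists>y\<in>U. wins_second W k (insert y D) (U - {y})"
  have "?P (LEAST k. ?P k)" using assms by (rule LeastI)
  then have "\<exists>y. y \<in> U \<and> wins_second W (LEAST k. ?P k) (insert y D) (U - {y})" by blast
  from someI_ex[OF this] assms
  have *: "best_move W D U \<in> U \<and>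
      wins_second W (LEAST k. ?P k) (insert (best_move W D U) D) (U - {best_move W D U})"
    unfolding best_move_def by auto
  moreover have "(LEAST k. ?P k) \<le> k" using assms by (rule Least_le)
  ultimately show "best_move W D U \<in> U"
    and "wins_second W k (insert (best_move W D U) D) (U - {best_move W D U})"
    using wins_second_le by blast+
qed

lemma best_move_in: "U \<noteq> {} \<Longrightarrow> best_move W D U \<in> U"
  using best_move_wins(1)[of U W _ D]
  by (cases "\<exists>k. \<exists>y\<in>U. wins_second W k (insert y D) (U - {y})")
    (auto simp: best_move_def some_in_eq)

definition best_strategy :: "'a pair_pre_digraph \<Rightarrow> game \<Rightarrow> 'a list \<Rightarrow> 'a" where
  "best_strategy G t h = best_move (dominating G) (set (dominator_moves t h)) (pverts G - set h)"

lemma dominator_strategy_best: "dominator_strategy G (best_strategy G t)"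
  unfolding dominator_strategy_def best_strategy_def by (intro allI impI best_move_in) auto

text \<open>A winning reply needs a free vertex, so the play cannot be over at \<open>i\<close>;
  this turns \<open>i \<le> length p\<close> into \<open>i < length p\<close>.\<close>

lemma best_strategy_step:
  assumes "p \<in> plays G t (best_strategy G t)" "dominator_turn t i"
    and "h = take i p" "i \<le> length p"
    and "\<exists>y\<in>pverts G - set h. wins_second (dominating G) k
      (insert y (set (dominator_moves t h))) (pverts G - set h - {y})"
  shows "i < length p"
    and "length (dominator_moves t (take (Suc i) p)) = Suc (length (dominator_moves t h))"
    and "wins_second (dominating G) k (set (dominator_moves t (take (Suc i) p)))
      (pverts G - set (take (Suc i) p))"
proof -
  have p: "set p = pverts G" using assms(1) by (simp add: plays_def)
  show i: "i < length p"
  proof (rule ccontr)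
    assume "\<not> i < length p"
    then have "h = p" using assms(3) by simp
    then show False using assms(5) p by auto
  qed
  define y where "y = best_move (dominating G) (set (dominator_moves t h)) (pverts G - set h)"
  have "p ! i = y"
    using assms(1,2,3) i by (auto simp: plays_def best_strategy_def y_def)
  then have hy: "take (Suc i) p = h @ [y]" using i assms(3) by (simp add: take_Suc_conv_app_nth)
  have len: "length h = i" using i assms(3) by simp
  have D: "dominator_moves t (take (Suc i) p) = dominator_moves t h @ [y]"
    using assms(2) len unfolding hy by (simp add: dominator_moves_snoc)
  then show "length (dominator_moves t (take (Suc i) p)) = Suc (length (dominator_moves t h))"
    by simp
  have "pverts G - set (take (Suc i) p) = pverts G - set h - {y}" unfolding hy by auto
  then show "wins_second (dominating G) k (set (dominator_moves t (take (Suc i) p)))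
      (pverts G - set (take (Suc i) p))"
    using best_move_wins(2)[OF assms(5)] unfolding D y_def by simp
qed

text \<open>One round is a move of Staller and a reply: \<open>i\<close> grows by two, the number of
  Dominator's moves by one, and \<open>k\<close> drops by one. The bound in the conclusion is
  therefore invariant until the position is won.\<close>

lemma best_strategy_winning_time:
  assumes "p \<in> plays G t (best_strategy G t)" "i \<le> length p" "\<not> dominator_turn t i"
    and "wins_second (dominating G) k (set (dominator_moves t (take i p))) (pverts G - set (take i p))"
  shows "winning_time G t p \<le> enat (length (dominator_moves t (take i p)) + k)"
proof -
  have p: "set p = pverts G" "distinct p" using assms(1) by (auto simp: plays_def)
  show ?thesis
    using assms(2-)
  proof (induction k arbitrary: i)
    case 0
    then show ?case using winning_time_leI[OF p(1)] by simp
  next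
    case (Suc k)
    let ?h = "take i p"
    show ?case
    proof (cases "dominating G (set (dominator_moves t ?h))")
      case True
      from winning_time_leI[OF p(1) True] show ?thesis
        by (rule order_trans) simp
    next
      case False
      let ?U = "pverts G - set ?h"
      have U: "?U \<noteq> {}" and reply: "\<And>x. x \<in> ?U \<Longrightarrow> \<exists>y\<in>?U - {x}. wins_second (dominating G) k
          (insert y (set (dominator_moves t ?h))) (?U - {x} - {y})"
        using Suc.prems(3) False unfolding wins_second.simps by blast+
      have i: "i < length p"
      proof (rule ccontr)
        assume "\<not> i < length p"
        then show False using U p(1) by simp
      qed
      then have hx: "take (Suc i) p = ?h @ [p ! i]" by (simp add: take_Suc_conv_app_nth)
      have "distinct (take (Suc i) p)" using p(2) by simp
      then have x: "p ! i \<in> ?U" unfolding hx using nth_mem[OF i] p(1) by simp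
      have D: "dominator_moves t (take (Suc i) p) = dominator_moves t ?h"
        using Suc.prems(2) i unfolding hx by (simp add: dominator_moves_snoc)
      have Ux: "pverts G - set (take (Suc i) p) = ?U - {p ! i}" unfolding hx by auto
      have turn: "dominator_turn t (Suc i)" using Suc.prems(2) by (simp add: dominator_turn_Suc)
      have "Suc i \<le> length p" using i by simp
      moreover have "\<exists>y\<in>pverts G - set (take (Suc i) p). wins_second (dominating G) k
          (insert y (set (dominator_moves t (take (Suc i) p)))) (pverts G - set (take (Suc i) p) - {y})"
        unfolding D Ux using reply[OF x] .
      ultimately have *: "Suc i < length p"
        "length (dominator_moves t (take (Suc (Suc i)) p)) = Suc (length (dominator_moves t (take (Suc i) p)))"
        "wins_second (dominating G) k (set (dominator_moves t (take (Suc (Suc i)) p)))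
          (pverts G - set (take (Suc (Suc i)) p))"
        by (rule best_strategy_step[OF assms(1) turn refl])+
      have "\<not> dominator_turn t (Suc (Suc i))" using turn by (simp add: dominator_turn_Suc)
      then have "winning_time G t p \<le> enat (length (dominator_moves t (take (Suc (Suc i)) p)) + k)"
        using Suc.IH[OF _ _ *(3)] *(1) by simp
      then show ?thesis using *(2) D by simp
    qed
  qed
qed

lemma game_value_leI:
  assumes "\<And>p. p \<in> plays G t (best_strategy G t) \<Longrightarrow> winning_time G t p \<le> enat k"
  shows "game_value G t \<le> enat k"
  unfolding game_value_def
  by (rule INF_lower2[of "best_strategy G t"]) (auto simp: dominator_strategy_best SUP_le_iff assms)

section \<open>Game values as budgets of the initial position\<close>

lemma gamma_MB'_le_iff:
  assumes "finite (pverts G)"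
  shows "\<gamma>'\<^sub>M\<^sub>B G \<le> enat k \<longleftrightarrow> wins_second (dominating G) k {} (pverts G)"
proof
  assume "\<gamma>'\<^sub>M\<^sub>B G \<le> enat k"
  then obtain \<sigma> where \<sigma>: "dominator_strategy G \<sigma>"
    "\<And>p. p \<in> plays G S_game \<sigma> \<Longrightarrow> winning_time G S_game p \<le> enat k"
    unfolding gamma_MB'_def by (rule game_value_leD) blast
  then show "wins_second (dominating G) k {} (pverts G)"
    using partial_play_wins_second[OF assms \<sigma>(1) Nil_partial_plays, of S_game k] by simp
next
  assume "wins_second (dominating G) k {} (pverts G)"
  then show "\<gamma>'\<^sub>M\<^sub>B G \<le> enat k"
    unfolding gamma_MB'_def
    using best_strategy_winning_time[of _ G S_game 0 k] by (intro game_value_leI) simp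
qed

lemma gamma_MB_le_iff:
  assumes "finite (pverts G)"
  shows "\<gamma>\<^sub>M\<^sub>B G \<le> enat k \<longleftrightarrow> wins_first (dominating G) k {} (pverts G)"
proof
  assume "\<gamma>\<^sub>M\<^sub>B G \<le> enat k"
  then obtain \<sigma> where \<sigma>: "dominator_strategy G \<sigma>"
    and win: "\<And>p. p \<in> plays G D_game \<sigma> \<Longrightarrow> winning_time G D_game p \<le> enat k"
    unfolding gamma_MB_def by (rule game_value_leD) blast
  show "wins_first (dominating G) k {} (pverts G)"
  \<comment> \<open>The empty set dominates only the graph without vertices, where no opening move
    \<open>\<sigma> []\<close> can be legal.\<close>
  proof (cases "dominating G {}")
    case True
    then show ?thesis by (cases k) auto
  next
    case False
    then have "set [] \<subset> pverts G" by (auto simp: dominating_def)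
    then have y: "\<sigma> [] \<in> pverts G - set []"
      using \<sigma> unfolding dominator_strategy_def by (metis distinct.simps(1))
    have h: "[\<sigma> []] \<in> partial_plays G D_game \<sigma>"
      using partial_plays_snoc[OF Nil_partial_plays y] by simp
    have D: "dominator_moves D_game [\<sigma> []] = [\<sigma> []]"
      using dominator_moves_snoc[of D_game "[]"] by simp
    obtain q where q: "[] @ q \<in> plays G D_game \<sigma>"
      using partial_plays_extend[OF assms \<sigma> Nil_partial_plays] by blast
    have "k \<noteq> 0"
    proof
      assume "k = 0"
      then show False using winning_time_leD[OF win[OF q]] False by simp
    qed
    then obtain l where l: "k = Suc l" by (cases k) auto
    have "wins_second (dominating G) l {\<sigma> []} (pverts G - {\<sigma> []})"
      using partial_play_wins_second[OF assms \<sigma> h, of l] win unfolding D l by simp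
    then show ?thesis using y l by auto
  qed
next
  assume first: "wins_first (dominating G) k {} (pverts G)"
  show "\<gamma>\<^sub>M\<^sub>B G \<le> enat k"
    unfolding gamma_MB_def
  proof (rule game_value_leI)
    fix p assume p: "p \<in> plays G D_game (best_strategy G D_game)"
    show "winning_time G D_game p \<le> enat k"
    proof (cases "dominating G {}")
      case True
      then have "winning_time G D_game p \<le> enat 0"
        using winning_time_leI[of p G D_game 0] p by (simp add: plays_def)
      then show ?thesis by (rule order_trans) simp
    next
      case False
      then obtain l where l: "k = Suc l"
        and "\<exists>y\<in>pverts G. wins_second (dominating G) l {y} (pverts G - {y})"
        using first by (cases k) auto
      \<comment> \<open>The opening move is made at index 0; from index 1 on Staller is to move and
        the budget is \<open>l\<close>.\<close>
      then show ?thesis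
        using best_strategy_step[OF p _ refl, of 0 l] best_strategy_winning_time[OF p, of 1 l]
        by (simp add: Suc_le_eq)
    qed
  qed
qed

section \<open>Cartesian products\<close>

text \<open>Stated for any \<open>P\<close> partitioned into copies of \<open>G\<close>, so that one
  proof serves both factors of the product. Only arcs inside the copies are required; further arcs
  of \<open>P\<close> can only help Dominator.\<close>

lemma gamma_MB_copies:
  fixes e :: "'j \<Rightarrow> 'a \<Rightarrow> 'c"
  assumes "finite (pverts G)" "finite J"
    and inj: "\<And>i j x y. e i x = e j y \<longleftrightarrow> i = j \<and> x = y"
    and verts: "pverts P = (\<Union>j\<in>J. e j ` pverts G)"
    and arcs: "\<And>j x y. j \<in> J \<Longrightarrow> (x, y) \<in> parcs G \<Longrightarrow> (e j x, e j y) \<in> parcs P"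
  shows "\<gamma>\<^sub>M\<^sub>B P \<le> \<gamma>\<^sub>M\<^sub>B G + enat (card J - 1) * \<gamma>'\<^sub>M\<^sub>B G"
    and "\<gamma>'\<^sub>M\<^sub>B P \<le> enat (card J) * \<gamma>'\<^sub>M\<^sub>B G"
proof -
  have finP: "finite (pverts P)" using assms(1,2) by (simp add: verts)
  interpret parallel_games J e "dominating G" "dominating P"
  proof
    fix D assume *: "\<And>j. j \<in> J \<Longrightarrow> dominating G (e j -` D)"
    show "dominating P D"
      unfolding dominating_def
    proof
      fix v assume v: "v \<in> pverts P - D"
      then obtain j x where j: "j \<in> J" "x \<in> pverts G" "v = e j x" by (auto simp: verts)
      then obtain y where "y \<in> e j -` D" "(x, y) \<in> parcs G"
        using *[OF j(1)] v by (auto simp: dominating_def)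
      then show "\<exists>u\<in>D. (v, u) \<in> parcs P" using arcs j by auto
    qed
  qed (use assms(2) inj mono_dominating in auto)
  have copy: "e j -` pverts P = pverts G" if "j \<in> J" for j
    using that by (auto simp: verts inj)
  have sub: "pverts P \<subseteq> (\<Union>j\<in>J. range (e j))" by (auto simp: verts)
  show "\<gamma>'\<^sub>M\<^sub>B P \<le> enat (card J) * \<gamma>'\<^sub>M\<^sub>B G"
  proof (cases "\<gamma>'\<^sub>M\<^sub>B G")
    case (enat b)
    then have "wins_second (dominating G) b {} (pverts G)"
      using gamma_MB'_le_iff[OF assms(1), of b] by simp
    then have "wins_second (dominating P) (sum (\<lambda>_. b) J) {} (pverts P)"
      by (intro wins_second_parallel) (auto simp: copy sub)
    then show ?thesis using gamma_MB'_le_iff[OF finP] enat by simp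
  next
    case infinity
    \<comment> \<open>In \<open>enat\<close>, zero times infinity is zero, so with no copies the
      bound is 0; then \<open>P\<close> has no vertices and its value is 0 as well.\<close>
    have "\<gamma>'\<^sub>M\<^sub>B P \<le> enat 0" if "card J = 0"
      using gamma_MB'_le_iff[OF finP, of 0] that assms(2) verts by (auto simp: dominating_def)
    then show ?thesis using infinity by (cases "card J = 0") (auto simp: zero_enat_def[symmetric])
  qed
  show "\<gamma>\<^sub>M\<^sub>B P \<le> \<gamma>\<^sub>M\<^sub>B G + enat (card J - 1) * \<gamma>'\<^sub>M\<^sub>B G"
  \<comment> \<open>Otherwise there are a copy \<open>j0\<close> to open in and a vertex of
    \<open>G\<close>, so that this copy is not won at the start.\<close>
  proof (cases "pverts P = {}")
    case True
    then have "\<gamma>\<^sub>M\<^sub>B P \<le> enat 0"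
      using gamma_MB_le_iff[OF finP, of 0] by (simp add: dominating_def)
    then show ?thesis by (simp add: zero_enat_def[symmetric])
  next
    case False
    then obtain j0 where j0: "j0 \<in> J" and ne: "pverts G \<noteq> {}" by (auto simp: verts)
    \<comment> \<open>The condition on \<open>b\<close> is restricted to copies other than
      \<open>j0\<close>, so it is vacuous when there is just one copy, even if
      \<open>\<gamma>'\<^sub>M\<^sub>B G\<close> is infinite.\<close>
    have bound: "\<gamma>\<^sub>M\<^sub>B P \<le> enat (a + (card J - 1) * b)"
      if a: "\<gamma>\<^sub>M\<^sub>B G = enat a"
        and b: "\<And>j. j \<in> J - {j0} \<Longrightarrow> wins_second (dominating G) b {} (pverts G)" for a b
    proof -
      have "wins_first (dominating G) a {} (pverts G)"
        using gamma_MB_le_iff[OF assms(1), of a] a by simp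
      then have "wins_first (dominating P) (a + (card J - 1) * b) {} (pverts P)"
        using b ne by (intro wins_first_parallel[OF j0]) (auto simp: copy j0 sub dominating_def)
      then show ?thesis using gamma_MB_le_iff[OF finP] by simp
    qed
    show ?thesis
    proof (cases "\<gamma>\<^sub>M\<^sub>B G")
      case (enat a)
      show ?thesis
      proof (cases "\<gamma>'\<^sub>M\<^sub>B G")
        case (enat b)
        then show ?thesis
          using bound[OF \<open>\<gamma>\<^sub>M\<^sub>B G = enat a\<close>, of b] gamma_MB'_le_iff[OF assms(1), of b]
            \<open>\<gamma>\<^sub>M\<^sub>B G = enat a\<close> by simp
      next
        case infinity
        show ?thesis
        \<comment> \<open>With a single copy the product with infinity is 0 and \<open>b = 0\<close>
          serves; with more copies the right-hand side is infinite.\<close>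
        proof (cases "card J = 1")
          case True
          then have "J - {j0} = {}" using j0 by (metis Diff_cancel card_1_singletonE singletonD)
          then show ?thesis using bound[OF enat, of 0] enat True by (auto simp: zero_enat_def[symmetric])
        next
          case False
          moreover have "0 < card J" using j0 assms(2) by (auto simp: card_gt_0_iff)
          ultimately have "card J - 1 \<noteq> 0" by simp
          then show ?thesis using infinity by (simp add: zero_enat_def)
        qed
      qed
    qed simp
  qed
qed

lemma finite_pverts:
  assumes "pair_graph G"
  shows "finite (pverts G)"
proof -
  interpret pair_graph G by fact
  show ?thesis by (rule pair_finite_verts)
qed

text \<open>In the S-game no copy is guaranteed to be opened by Dominator, so both bounds carry
  \<open>\<gamma>'\<^sub>M\<^sub>B\<close>. In the first one
  \<open>\<gamma>\<^sub>M\<^sub>B G\<close> would be too small: for \<open>H\<close> a single vertex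
  and \<open>G\<close> a hub joined to all vertices of a 4-cycle,
  \<open>\<gamma>\<^sub>M\<^sub>B G\<close> is 1, while \<open>\<gamma>'\<^sub>M\<^sub>B G\<close>
  and \<open>\<gamma>'\<^sub>M\<^sub>B (G \<box> H)\<close> are 2.\<close>

theorem theorem2:
  fixes G :: "'a pair_pre_digraph" and H :: "'b pair_pre_digraph" and n m :: nat
  assumes "pair_graph G" and "pair_graph H"
    and "card (pverts G) = n" and "card (pverts H) = m"
    and "(dominator_has_winning_strategy G D_game \<and> dominator_has_winning_strategy G S_game) \<or>
         (dominator_has_winning_strategy H D_game \<and> dominator_has_winning_strategy H S_game)"
  shows "\<gamma>\<^sub>M\<^sub>B (G \<box> H) \<le>
           min (\<gamma>\<^sub>M\<^sub>B G + enat (m - 1) * \<gamma>'\<^sub>M\<^sub>B G) (\<gamma>\<^sub>M\<^sub>B H + enat (n - 1) * \<gamma>'\<^sub>M\<^sub>B H) \<and>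
         \<gamma>'\<^sub>M\<^sub>B (G \<box> H) \<le> min (enat m * \<gamma>'\<^sub>M\<^sub>B G) (enat n * \<gamma>'\<^sub>M\<^sub>B H)"
proof -
  have fin: "finite (pverts G)" "finite (pverts H)"
    by (rule finite_pverts[OF assms(1)] finite_pverts[OF assms(2)])+
  have verts: "pverts (G \<box> H) = pverts G \<times> pverts H"
    and arcs: "\<And>j x y. j \<in> pverts H \<Longrightarrow> (x, y) \<in> parcs G \<Longrightarrow> ((x, j), (y, j)) \<in> parcs (G \<box> H)"
      "\<And>i x y. i \<in> pverts G \<Longrightarrow> (x, y) \<in> parcs H \<Longrightarrow> ((i, x), (i, y)) \<in> parcs (G \<box> H)"
    by (simp_all add: cartesian_product_def)
  have "pverts (G \<box> H) = (\<Union>j\<in>pverts H. (\<lambda>g. (g, j)) ` pverts G)"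
    "pverts (G \<box> H) = (\<Union>i\<in>pverts G. Pair i ` pverts H)"
    unfolding verts by blast+
  \<comment> \<open>Fixing a vertex of \<open>H\<close> gives a copy of \<open>G\<close>, so there
    are \<open>m\<close> of these; fixing a vertex of \<open>G\<close> gives one of the
    \<open>n\<close> copies of \<open>H\<close>.\<close>
  note left = gamma_MB_copies[of G "pverts H" "\<lambda>h g. (g, h)", OF fin _ this(1) arcs(1)]
    and right = gamma_MB_copies[of H "pverts G" Pair, OF fin(2,1) _ this(2) arcs(2)]
  have "\<gamma>\<^sub>M\<^sub>B (G \<box> H) \<le> \<gamma>\<^sub>M\<^sub>B G + enat (card (pverts H) - 1) * \<gamma>'\<^sub>M\<^sub>B G"
    by (rule left(1)) auto
  moreover have "\<gamma>\<^sub>M\<^sub>B (G \<box> H) \<le> \<gamma>\<^sub>M\<^sub>B H + enat (card (pverts G) - 1) * \<gamma>'\<^sub>M\<^sub>B H"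
    by (rule right(1)) auto
  moreover have "\<gamma>'\<^sub>M\<^sub>B (G \<box> H) \<le> enat (card (pverts H)) * \<gamma>'\<^sub>M\<^sub>B G"
    by (rule left(2)) auto
  moreover have "\<gamma>'\<^sub>M\<^sub>B (G \<box> H) \<le> enat (card (pverts G)) * \<gamma>'\<^sub>M\<^sub>B H"
    by (rule right(2)) auto
  ultimately show ?thesis using assms(3,4) by simp
qed

end
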